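(* Let $n\ge 1$ and let $\phi_a:\mathbb{C}^{n^2}\to\mathbb{C}^{2^n}$ be the affine principal minor map, which sends a complex $n\times n$-matrix $A$ to the vector $A_*=(A_I)_{I\subseteq [n]}$ of all its principal minors. Then the image of $\phi_a$ is closed in $\mathbb{C}^{2^n}$.
   Context: $[n]=\{1,2,\dots,n\}$. For a complex $n\times n$-matrix $A$ and $I\subseteq[n]$, $A_I$ denotes the principal minor of $A$, i.e. the determinant of the submatrix with rows and columns indexed by $I$, with the convention $A_\emptyset=1$. The space $\mathbb{C}^{n^2}$ is identified with the space of complex $n\times n$-matrices, and the coordinates of $\mathbb{C}^{2^n}$ are indexed by the subsets of $[n]$. "Closed" means Zariski closed, i.e. the image is a complex algebraic variety; since the image of a polynomial map is constructible, this is equivalent to being closed in the Euclidean topology. *)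

theory Defs
  imports
    Complex_Main
    "HOL-Library.FuncSet"
    "HOL-Library.Poly_Mapping"
    "Jordan_Normal_Form.Determinant"
    "Jordan_Normal_Form.DL_Submatrix"
begin

text \<open>
  A polynomial in variables indexed by \<^typ>\<open>'v\<close> is a finitely supported map from monomials
  to coefficients, a monomial being a finitely supported map from variables to exponents.
\<close>

type_synonym 'v cpoly = "('v \<Rightarrow>\<^sub>0 nat) \<Rightarrow>\<^sub>0 complex"

definition poly_vars :: "'v cpoly \<Rightarrow> 'v set" where
  "poly_vars p = (\<Union>m\<in>Poly_Mapping.keys p. Poly_Mapping.keys m)"

definition poly_eval :: "'v cpoly \<Rightarrow> ('v \<Rightarrow> complex) \<Rightarrow> complex" where
  "poly_eval p x =
     (\<Sum>m\<in>Poly_Mapping.keys p.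
        Poly_Mapping.lookup p m * (\<Prod>v\<in>Poly_Mapping.keys m. x v ^ Poly_Mapping.lookup m v))"

text \<open>
  Complex affine space with coordinates indexed by \<^term>\<open>J\<close>. Its points are extensional
  functions, so that a point is determined by its coordinates in \<^term>\<open>J\<close>.
\<close>

definition affine_space :: "'v set \<Rightarrow> ('v \<Rightarrow> complex) set" where
  "affine_space J = (J \<rightarrow>\<^sub>E UNIV)"

definition zero_locus :: "'v set \<Rightarrow> 'v cpoly set \<Rightarrow> ('v \<Rightarrow> complex) set" where
  "zero_locus J P = {x \<in> affine_space J. \<forall>p\<in>P. poly_eval p x = 0}"

definition zariski_closed_in :: "'v set \<Rightarrow> ('v \<Rightarrow> complex) set \<Rightarrow> bool" where
  "zariski_closed_in J Z \<longleftrightarrow> (\<exists>P. (\<forall>p\<in>P. poly_vars p \<subseteq> J) \<and> Z = zero_locus J P)"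

text \<open>
  Rows and columns of a matrix in \<^term>\<open>carrier_mat n n\<close> are numbered from 0, so
  \<^term>\<open>{..<n}\<close> plays the role of the index set \<open>{1, \<dots>, n}\<close>.
\<close>

definition principal_minor :: "complex mat \<Rightarrow> nat set \<Rightarrow> complex" where
  "principal_minor A I = det (submatrix A I I)"

lemma principal_minor_empty: "principal_minor A {} = 1"
  by (simp add: principal_minor_def submatrix_def det_def)

definition affine_principal_minor_map :: "nat \<Rightarrow> complex mat \<Rightarrow> nat set \<Rightarrow> complex" where
  "affine_principal_minor_map n A = (\<lambda>I\<in>Pow {..<n}. principal_minor A I)"

end

theory Submission
  imports
    Defs
    "HOL-Library.Function_Algebras"
    "HOL-Computational_Algebra.Fundamental_Theorem_Algebra"
    "HOL-Combinatorics.Cycles"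
begin

text \<open>
  A point \<open>y\<close> of the Zariski closure of the image defines a ring homomorphism to the complex
  numbers on the algebra generated by the principal minors as functions of the matrix. For an
  index set \<open>I\<close>, the products of the entries along the cycles through all of \<open>I\<close> are integral
  over the principal minors and the products along shorter cycles: exchanging tails shows that
  the product of two different such weights is a combination of such weights, and the minor
  expresses the square of one of them through products of two different ones. By induction on
  the length of the cycles the homomorphism extends to the weights of all closed walks. Such a
  homomorphism is evaluation at some matrix, whose principal minors are then the coordinates
  of \<open>y\<close>.
\<close>

subsection \<open>Extension of homomorphisms along integral elements\<close>

text \<open>A polynomial map can fail to have closed image when the preimages of a bounded set
  escape to infinity, and here they do: conjugation by an invertible diagonal matrix changes no
  principal minor but scales an off-diagonal entry by an arbitrary nonzero factor. Hence these
  entries are not integral over the minors, and a homomorphism cannot be extended to them by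
  integrality. Products along closed walks are unchanged by such conjugations and do become
  integral, one length at a time. This forces two stages of different nature: extension through
  integral elements as far as the cycle weights, then an explicit construction of a matrix from the
  values of these invariants. Homomorphisms are kept as graphs inside one fixed ring, so that
  enlarging the subring is plain set inclusion.\<close>

text \<open>\<open>H\<close> is the graph of a surjective ring homomorphism from the subring \<open>Domain H\<close> to the complex
  numbers.\<close>

locale partial_hom =
  fixes H :: "('r::comm_ring_1 \<times> complex) set"
  assumes onto: "\<exists>r. (r, z) \<in> H"
    and one: "(1, 1) \<in> H"
    and add: "(f, u) \<in> H \<Longrightarrow> (g, v) \<in> H \<Longrightarrow> (f + g, u + v) \<in> H"
    and mult: "(f, u) \<in> H \<Longrightarrow> (g, v) \<in> H \<Longrightarrow> (f * g, u * v) \<in> H"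
    and uminus: "(f, u) \<in> H \<Longrightarrow> (- f, - u) \<in> H"
    and zeroD: "(0, v) \<in> H \<Longrightarrow> v = 0"
begin

lemma zero: "(0, 0) \<in> H"
  using add[OF one uminus[OF one]] by simp

lemma unique:
  assumes "(f, u) \<in> H" "(f, v) \<in> H"
  shows "u = v"
  using zeroD[of "u + - v"] add[OF assms(1) uminus[OF assms(2)]] by simp

lemma sum: "(\<And>i. i \<in> S \<Longrightarrow> (f i, u i) \<in> H) \<Longrightarrow> (sum f S, sum u S) \<in> H"
  by (induction S rule: infinite_finite_induct) (auto simp: zero intro: add)

lemma prod: "(\<And>i. i \<in> S \<Longrightarrow> (f i, u i) \<in> H) \<Longrightarrow> (prod f S, prod u S) \<in> H"
  by (induction S rule: infinite_finite_induct) (auto simp: one intro: mult)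

lemma sign: "s \<in> {1, -1} \<Longrightarrow> (of_int s, of_int s) \<in> H"
  using one uminus[OF one] by auto

lemma det:
  assumes "B \<in> carrier_mat k k" "C \<in> carrier_mat k k"
    and "\<And>i j. i < k \<Longrightarrow> j < k \<Longrightarrow> (B $$ (i, j), C $$ (i, j)) \<in> H"
  shows "(det B, det C) \<in> H"
  unfolding det_def'[OF assms(1)] det_def'[OF assms(2)]
proof (intro sum mult prod assms(3))
  fix p i assume "p \<in> {p. p permutes {0..<k}}" "i \<in> {0..<k}"
  then show "p i < k" using permutes_in_image by fastforce
next
  fix p :: "nat \<Rightarrow> nat"
  show "(signof p, signof p) \<in> H" by (rule sign) (auto simp: sign_def)
qed auto

lemma Domain_add: "f \<in> Domain H \<Longrightarrow> g \<in> Domain H \<Longrightarrow> f + g \<in> Domain H"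
  by (meson add Domain_iff)

lemma Domain_mult: "f \<in> Domain H \<Longrightarrow> g \<in> Domain H \<Longrightarrow> f * g \<in> Domain H"
  by (meson mult Domain_iff)

lemma Domain_uminus: "f \<in> Domain H \<Longrightarrow> - f \<in> Domain H"
  by (meson uminus Domain_iff)

lemma Domain_0: "0 \<in> Domain H"
  using zero by blast

lemma Domain_1: "1 \<in> Domain H"
  using one by blast

lemma Domain_sum: "(\<And>i. i \<in> S \<Longrightarrow> f i \<in> Domain H) \<Longrightarrow> sum f S \<in> Domain H"
  by (induction S rule: infinite_finite_induct) (auto simp: Domain_0 Domain_add)

end

section \<open>Integrality by finitely generated modules, and lying over\<close>

definition span_over :: "'r::comm_ring_1 set \<Rightarrow> 'r set \<Rightarrow> 'r set" where
  "span_over D G = {\<Sum>g\<in>G. r g * g | r. \<forall>g\<in>G. r g \<in> D}"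

text \<open>Integrality in the module form: a finitely generated module over \<open>D\<close> that
  contains \<open>1\<close> and is stable under multiplication by \<open>c\<close>. Cycle weights
  satisfy this form directly, without a monic equation being written down.\<close>

definition integral_over :: "'r::comm_ring_1 set \<Rightarrow> 'r \<Rightarrow> bool" where
  "integral_over D c \<longleftrightarrow> (\<exists>G. finite G \<and> 1 \<in> G \<and> (\<forall>g\<in>G. c * g \<in> span_over D G))"

lemma span_over_mono: "D \<subseteq> D' \<Longrightarrow> span_over D G \<subseteq> span_over D' G"
  unfolding span_over_def by blast

lemma integral_over_mono: "integral_over D c \<Longrightarrow> D \<subseteq> D' \<Longrightarrow> integral_over D' c"
  unfolding integral_over_def by (meson span_over_mono subsetD)

lemma span_overI: "x = (\<Sum>g\<in>G. r g * g) \<Longrightarrow> \<forall>g\<in>G. r g \<in> D \<Longrightarrow> x \<in> span_over D G"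
  unfolding span_over_def by blast

lemma (in partial_hom) span_base:
  assumes "finite G" "g \<in> G" "d \<in> Domain H"
  shows "d * g \<in> span_over (Domain H) G"
proof -
  have "(\<Sum>h\<in>G. (if h = g then d else 0) * h) = (\<Sum>h\<in>G. if h = g then d * h else 0)"
    by (rule sum.cong) auto
  also have "\<dots> = d * g"
    using assms(1,2) by simp
  finally have "d * g = (\<Sum>h\<in>G. (if h = g then d else 0) * h)" ..
  then show ?thesis
    using assms Domain_0 by (intro span_overI[of _ "\<lambda>h. if h = g then d else 0"]) auto
qed

lemma (in partial_hom) span_add:
  assumes "x \<in> span_over (Domain H) G" "y \<in> span_over (Domain H) G"
  shows "x + y \<in> span_over (Domain H) G"
proof -
  obtain r s where "x = (\<Sum>g\<in>G. r g * g)" "\<forall>g\<in>G. r g \<in> Domain H"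
    "y = (\<Sum>g\<in>G. s g * g)" "\<forall>g\<in>G. s g \<in> Domain H"
    using assms unfolding span_over_def by blast
  then have "x + y = (\<Sum>g\<in>G. (r g + s g) * g)" "\<forall>g\<in>G. r g + s g \<in> Domain H"
    by (auto simp: sum.distrib algebra_simps intro: Domain_add)
  then show ?thesis by (rule span_overI)
qed

lemma (in partial_hom) span_scale:
  assumes "x \<in> span_over (Domain H) G" "d \<in> Domain H"
  shows "d * x \<in> span_over (Domain H) G"
proof -
  obtain r where "x = (\<Sum>g\<in>G. r g * g)" "\<forall>g\<in>G. r g \<in> Domain H"
    using assms unfolding span_over_def by blast
  then have "d * x = (\<Sum>g\<in>G. (d * r g) * g)" "\<forall>g\<in>G. d * r g \<in> Domain H"
    using assms(2) by (auto simp: sum_distrib_left algebra_simps intro: Domain_mult)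
  then show ?thesis by (rule span_overI)
qed

lemma (in partial_hom) span_sum:
  assumes "\<And>i. i \<in> S \<Longrightarrow> f i \<in> span_over (Domain H) G"
  shows "sum f S \<in> span_over (Domain H) G"
proof -
  have "0 \<in> span_over (Domain H) G"
    unfolding span_over_def using Domain_0 by (auto intro!: exI[of _ "\<lambda>_. 0"])
  then show ?thesis
    using assms by (induction S rule: infinite_finite_induct) (auto intro: span_add)
qed

text \<open>A nonzero element of least degree divides all others by division with remainder. It is
  not constant, since \<open>1\<close> is not in \<open>J\<close>, so the fundamental theorem of
  algebra gives it a root.\<close>

lemma proper_ideal_common_root:
  fixes J :: "complex poly set"
  assumes "0 \<in> J" "1 \<notin> J"
    and add: "\<And>p q. p \<in> J \<Longrightarrow> q \<in> J \<Longrightarrow> p + q \<in> J"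
    and mult: "\<And>p q. p \<in> J \<Longrightarrow> q * p \<in> J"
  shows "\<exists>z. \<forall>p\<in>J. poly p z = 0"
proof (cases "\<exists>g. g \<in> J \<and> g \<noteq> 0")
  case True
  then obtain g where g: "g \<in> J" "g \<noteq> 0"
    and min: "\<And>h. h \<in> J \<Longrightarrow> h \<noteq> 0 \<Longrightarrow> degree g \<le> degree h"
    using ex_has_least_nat[of "\<lambda>g. g \<in> J \<and> g \<noteq> 0" _ degree] by blast
  have "degree g \<noteq> 0"
  proof
    assume "degree g = 0"
    then obtain a where a: "g = [:a:]" by (rule degree_eq_zeroE)
    then have "[:1 / a:] * g = 1" using g(2) by (simp add: one_pCons)
    then show False using mult[OF g(1), of "[:1 / a:]"] \<open>1 \<notin> J\<close> by simp
  qed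
  then obtain z where z: "poly g z = 0"
    using fundamental_theorem_of_algebra[of g] constant_degree[of g] by auto
  have "g dvd h" if "h \<in> J" for h
  proof -
    have "h mod g = h + (- (h div g)) * g"
      by (simp add: minus_div_mult_eq_mod [symmetric])
    then have "h mod g \<in> J" using add[OF that mult[OF g(1)]] by metis
    then have "h mod g = 0"
      using min[of "h mod g"] degree_mod_less[OF g(2), of h] by fastforce
    then show ?thesis by auto
  qed
  then show ?thesis using z by (metis dvdE mult_zero_left poly_mult)
next
  case False
  then have "\<forall>p\<in>J. poly p 0 = 0" by auto
  then show ?thesis by blast
qed

lemma (in partial_hom) lift_poly: "\<exists>q. \<forall>i. (coeff q i, coeff p i) \<in> H"
proof (induction p)
  case 0
  show ?case using zero by (intro exI[of _ 0]) simp
next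
  case (pCons a p)
  then obtain q where "\<forall>i. (coeff q i, coeff p i) \<in> H" by blast
  moreover obtain r where "(r, a) \<in> H" using onto by blast
  ultimately show ?case
    by (intro exI[of _ "pCons r q"]) (simp add: coeff_pCons split: nat.split)
qed

text \<open>The determinant trick: if \<open>q(c) = 0\<close> and \<open>q\<close> reduced to \<open>1\<close>, then multiplication by \<open>q(c)\<close>
  on the generators would be given both by zero and by a matrix reducing to the identity.\<close>

lemma (in partial_hom) one_not_reduction:
  assumes "integral_over (Domain H) c"
    and q: "\<forall>i. (coeff q i, coeff 1 i) \<in> H" and "poly q c = 0"
  shows False
proof -
  obtain G where G: "finite G" "1 \<in> G" "\<And>g. g \<in> G \<Longrightarrow> c * g \<in> span_over (Domain H) G"
    using assms(1) unfolding integral_over_def by blast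
  define N where "N = card G"
  obtain e where e: "bij_betw e {0..<N} G"
    using ex_bij_betw_nat_finite[OF G(1)] unfolding N_def by blast
  have "\<exists>r. (\<forall>j<N. r j \<in> Domain H) \<and> c * e i = (\<Sum>j=0..<N. r j * e j)" if "i < N" for i
  proof -
    have eG: "e j \<in> G" if "j < N" for j using bij_betwE[OF e] that by simp
    then have "e i \<in> G" using \<open>i < N\<close> .
    then obtain r where r: "c * e i = (\<Sum>g\<in>G. r g * g)" "\<forall>g\<in>G. r g \<in> Domain H"
      using G(3) unfolding span_over_def by blast
    have "(\<Sum>g\<in>G. r g * g) = (\<Sum>j=0..<N. r (e j) * e j)"
      using sum.reindex_bij_betw[OF e, of "\<lambda>g. r g * g"] by simp
    then show ?thesis using r eG by (intro exI[of _ "\<lambda>j. r (e j)"]) simp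
  qed
  then obtain M where M: "\<And>i j. i < N \<Longrightarrow> j < N \<Longrightarrow> M i j \<in> Domain H"
    "\<And>i. i < N \<Longrightarrow> c * e i = (\<Sum>j=0..<N. M i j * e j)"
    by metis
  \<comment> \<open>\<open>P k\<close> is the \<open>k\<close>-th power of the matrix
    \<open>M\<close> of multiplication by \<open>c\<close> on the generators, kept as a function of
    two indices; \<open>b\<close> below is then \<open>q(M)\<close>.\<close>
  define P where "P = rec_nat (\<lambda>i j. if i = j then 1 else 0) (\<lambda>_ R i j. \<Sum>l=0..<N. M i l * R l j)"
  have P0: "P 0 i j = (if i = j then 1 else 0)"
    and PS: "P (Suc k) i j = (\<Sum>l=0..<N. M i l * P k l j)" for i j k
    unfolding P_def by simp_all
  have PD: "i < N \<Longrightarrow> j < N \<Longrightarrow> P k i j \<in> Domain H" for k i j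
    by (induction k arbitrary: i j)
      (auto simp: P0 PS Domain_0 Domain_1 intro!: Domain_sum Domain_mult M(1))
  have Pe: "i < N \<Longrightarrow> c ^ k * e i = (\<Sum>j=0..<N. P k i j * e j)" for k i
  proof (induction k arbitrary: i)
    case 0
    then show ?case by (simp add: P0 if_distrib [of "\<lambda>x. x * _"] cong: if_cong)
  next
    case (Suc k)
    have "c ^ Suc k * e i = c ^ k * (\<Sum>l=0..<N. M i l * e l)"
      unfolding M(2)[OF Suc.prems, symmetric] by (simp add: algebra_simps)
    also have "\<dots> = (\<Sum>l=0..<N. M i l * (c ^ k * e l))"
      by (simp add: sum_distrib_left algebra_simps)
    also have "\<dots> = (\<Sum>l=0..<N. \<Sum>j=0..<N. M i l * (P k l j * e j))"
      using Suc.IH by (simp add: sum_distrib_left)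
    also have "\<dots> = (\<Sum>j=0..<N. \<Sum>l=0..<N. M i l * (P k l j * e j))"
      by (rule sum.swap)
    also have "\<dots> = (\<Sum>j=0..<N. P (Suc k) i j * e j)"
      by (simp add: PS sum_distrib_right mult.assoc)
    finally show ?case .
  qed
  define b where "b i j = (\<Sum>k\<le>degree q. coeff q k * P k i j)" for i j
  \<comment> \<open>Among the coefficients of \<open>q\<close> only the constant one has a nonzero
    value, namely \<open>1\<close>, so \<open>q(M)\<close> has the same value as \<open>P 0\<close>,
    entry by entry.\<close>
  have bH: "(b i j, if i = j then 1 else 0) \<in> H" if ij: "i < N" "j < N" for i j
  proof -
    obtain v where v: "\<And>k. (P k i j, v k) \<in> H" using PD[OF ij] by (meson Domain_iff)
    have "(b i j, \<Sum>k\<le>degree q. coeff 1 k * v k) \<in> H"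
      unfolding b_def using q v by (intro sum mult) auto
    also have "(\<Sum>k\<le>degree q. coeff 1 k * v k) = v 0"
      by (simp add: coeff_1 if_distrib [of "\<lambda>x. x * _"] cong: if_cong)
    also have "v 0 = (if i = j then 1 else 0)"
      using v[of 0] unique[OF one] unique[OF zero] by (auto simp: P0)
    finally show ?thesis .
  qed
  have be: "(\<Sum>j=0..<N. b i j * e j) = 0" if "i < N" for i
  proof -
    have "(\<Sum>j=0..<N. b i j * e j) = (\<Sum>j=0..<N. \<Sum>k\<le>degree q. coeff q k * (P k i j * e j))"
      by (simp add: b_def sum_distrib_right mult.assoc)
    also have "\<dots> = (\<Sum>k\<le>degree q. \<Sum>j=0..<N. coeff q k * (P k i j * e j))"
      by (rule sum.swap)
    also have "\<dots> = (\<Sum>k\<le>degree q. coeff q k * c ^ k * e i)"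
      using Pe[OF that] by (simp add: sum_distrib_left mult.assoc)
    also have "\<dots> = poly q c * e i"
      by (simp add: poly_altdef sum_distrib_right)
    finally show ?thesis using assms(3) by simp
  qed
  define B where "B = mat N N (\<lambda>(i, j). b i j)"
  have B: "B \<in> carrier_mat N N" unfolding B_def by simp
  have "(det B, det (1\<^sub>m N)) \<in> H"
    using bH by (intro det[OF B]) (simp_all add: B_def)
  moreover have "det B = 0"
  proof -
    \<comment> \<open>\<open>B\<close> kills the vector of generators. Multiplying by the adjugate
      shows that \<open>det B\<close> kills every generator, and one generator is
      \<open>1\<close>.\<close>
    define x where "x = vec N e"
    have x: "x \<in> carrier_vec N" unfolding x_def by simp
    have "B *\<^sub>v x = 0\<^sub>v N"
      by (rule eq_vecI) (auto simp: B_def x_def scalar_prod_def be)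
    then have "(adj_mat B * B) *\<^sub>v x = adj_mat B *\<^sub>v 0\<^sub>v N"
      using adj_mat(1)[OF B] B x by (simp add: assoc_mult_mat_vec)
    also have "\<dots> = 0\<^sub>v N" using adj_mat(1)[OF B] by auto
    finally have *: "(det B \<cdot>\<^sub>m 1\<^sub>m N) *\<^sub>v x = 0\<^sub>v N" using adj_mat(3)[OF B] by simp
    obtain i where i: "i < N" "e i = 1" using e G(2) by (auto simp: bij_betw_def)
    have "((det B \<cdot>\<^sub>m 1\<^sub>m N) *\<^sub>v x) $ i = det B * e i"
      using i x by (simp add: x_def scalar_prod_def if_distrib [of "\<lambda>y. _ * y * _"] cong: if_cong)
    then show ?thesis using * i by simp
  qed
  ultimately show False using zeroD[of 1] by simp
qed

text \<open>Lying over for one element. The reductions of polynomials vanishing at \<open>c\<close>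
  form an ideal \<open>J\<close> of the complex polynomials. Integrality makes \<open>J\<close>
  proper, and a common root \<open>z\<close> of \<open>J\<close> can serve as the value of
  \<open>c\<close>: well-definedness says exactly that \<open>J\<close> vanishes at
  \<open>z\<close>.\<close>

lemma (in partial_hom) extend_integral:
  assumes "integral_over (Domain H) c"
  shows "\<exists>H'. partial_hom H' \<and> H \<subseteq> H' \<and> c \<in> Domain H'"
proof -
  define C where "C = {(q, p). \<forall>i. (coeff q i, coeff p i) \<in> H}"
  have Cadd: "(q + q', p + p') \<in> C" if "(q, p) \<in> C" "(q', p') \<in> C" for q q' p p'
    using that add unfolding C_def by simp
  have Cuminus: "(- q, - p) \<in> C" if "(q, p) \<in> C" for q p
    using that uminus unfolding C_def by simp
  have Cmult: "(q * q', p * p') \<in> C" if "(q, p) \<in> C" "(q', p') \<in> C" for q q' p p'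
    using that unfolding C_def by (auto simp: coeff_mult intro!: sum mult)
  have Cconst: "([:f:], [:u:]) \<in> C" if "(f, u) \<in> H" for f u
    unfolding C_def using that zero by (auto simp: coeff_pCons split: nat.splits)
  have CX: "([:0, 1:], [:0, 1:]) \<in> C"
    unfolding C_def using zero one by (auto simp: coeff_pCons split: nat.splits)
  define J where "J = {p. \<exists>q. (q, p) \<in> C \<and> poly q c = 0}"
  have "\<exists>z. \<forall>p\<in>J. poly p z = 0"
  proof (rule proper_ideal_common_root)
    show "0 \<in> J" unfolding J_def C_def using zero by (auto intro!: exI[of _ 0])
    show "1 \<notin> J" using one_not_reduction[OF assms] unfolding J_def C_def by blast
    show "p + q \<in> J" if pq: "p \<in> J" "q \<in> J" for p q
    proof -
      obtain p' q' where "(p', p) \<in> C" "poly p' c = 0" "(q', q) \<in> C" "poly q' c = 0"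
        using pq unfolding J_def by blast
      then have "(p' + q', p + q) \<in> C" "poly (p' + q') c = 0" by (auto intro: Cadd)
      then show ?thesis unfolding J_def by blast
    qed
    show "q * p \<in> J" if p: "p \<in> J" for p q
    proof -
      obtain q' where "(q', q) \<in> C" using lift_poly[of q] unfolding C_def by auto
      moreover obtain p' where "(p', p) \<in> C" "poly p' c = 0"
        using p unfolding J_def by blast
      ultimately have "(q' * p', q * p) \<in> C" "poly (q' * p') c = 0" by (auto intro: Cmult)
      then show ?thesis unfolding J_def by blast
    qed
  qed
  then obtain z where z: "\<And>p. p \<in> J \<Longrightarrow> poly p z = 0" by blast
  define H' where "H' = {(poly q c, poly p z) | q p. (q, p) \<in> C}"
  have H'I: "(x, y) \<in> H'" if "(q, p) \<in> C" "x = poly q c" "y = poly p z" for q p x y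
    using that unfolding H'_def by blast
  have sub: "H \<subseteq> H'" using H'I[OF Cconst] by auto
  have "partial_hom H'"
  proof
    show "\<exists>r. (r, w) \<in> H'" for w using onto[of w] sub by blast
    show "(1, 1) \<in> H'" using one sub by blast
    show "v = 0" if "(0, v) \<in> H'" for v
      using that z unfolding H'_def J_def by fastforce
    fix f u assume "(f, u) \<in> H'"
    then obtain q p where 1: "(q, p) \<in> C" "f = poly q c" "u = poly p z" unfolding H'_def by blast
    show "(- f, - u) \<in> H'" by (rule H'I[OF Cuminus[OF 1(1)]]) (simp_all add: 1)
    fix g v assume "(g, v) \<in> H'"
    then obtain q' p' where 2: "(q', p') \<in> C" "g = poly q' c" "v = poly p' z" unfolding H'_def by blast
    show "(f + g, u + v) \<in> H'" by (rule H'I[OF Cadd[OF 1(1) 2(1)]]) (simp_all add: 1 2)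
    show "(f * g, u * v) \<in> H'" by (rule H'I[OF Cmult[OF 1(1) 2(1)]]) (simp_all add: 1 2)
  qed
  moreover have "(c, z) \<in> H'" by (rule H'I[OF CX]) simp_all
  ultimately show ?thesis using sub by blast
qed

lemma extend_finite_integral:
  assumes "finite F" "partial_hom H" "\<And>c. c \<in> F \<Longrightarrow> integral_over (Domain H) c"
  shows "\<exists>H'. partial_hom H' \<and> H \<subseteq> H' \<and> F \<subseteq> Domain H'"
  using assms
proof (induction F)
  case (insert c F)
  then obtain H1 where H1: "partial_hom H1" "H \<subseteq> H1" "F \<subseteq> Domain H1" by auto
  have "integral_over (Domain H1) c"
    using insert.prems H1(2) by (auto intro: integral_over_mono)
  then obtain H2 where "partial_hom H2" "H1 \<subseteq> H2" "c \<in> Domain H2"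
    using partial_hom.extend_integral[OF H1(1)] by blast
  then show ?case using H1 by (intro exI[of _ H2]) blast
qed auto

subsection \<open>Weights of closed walks and of permutations\<close>

fun path_weight :: "('v \<Rightarrow> 'v \<Rightarrow> 'r::comm_ring_1) \<Rightarrow> 'v list \<Rightarrow> 'r" where
  "path_weight a (x # y # ys) = a x y * path_weight a (y # ys)"
| "path_weight a _ = 1"

text \<open>The list omits the return to its first vertex, so its length is the number of steps and
  \<open>[i]\<close> is the loop with weight \<open>a i i\<close>.\<close>

definition cycle_weight :: "('v \<Rightarrow> 'v \<Rightarrow> 'r::comm_ring_1) \<Rightarrow> 'v list \<Rightarrow> 'r" where
  "cycle_weight a xs = path_weight a (xs @ [hd xs])"

lemma path_weight_append:
  "path_weight a (xs @ v # ys) = path_weight a (xs @ [v]) * path_weight a (v # ys)"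
proof (induction xs)
  case (Cons x xs)
  then show ?case by (cases xs) (auto simp: mult.assoc)
qed simp

lemma path_weight_append2:
  "path_weight a (x # xs @ v # ys) = path_weight a (x # xs @ [v]) * path_weight a (v # ys)"
  using path_weight_append[of a "x # xs" v ys] by simp

lemma cycle_weight_rotate: "cycle_weight a (xs @ ys) = cycle_weight a (ys @ xs)"
proof (cases "xs = [] \<or> ys = []")
  case False
  then obtain x xs' y ys' where "xs = x # xs'" "ys = y # ys'" by (metis neq_Nil_conv)
  then show ?thesis
    using path_weight_append2[of a x xs' y "ys' @ [x]"] path_weight_append2[of a y ys' x "xs' @ [y]"]
    by (simp add: cycle_weight_def mult.commute)
qed auto

text \<open>Rotated to start at \<open>x\<close>, a closed walk meeting \<open>x\<close> twice is
  the concatenation of two closed walks based at \<open>x\<close>. All reductions of lists with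
  repetitions rest on this.\<close>

lemma cycle_weight_split:
  "cycle_weight a (us @ x # vs @ x # ws) = cycle_weight a (us @ x # ws) * cycle_weight a (x # vs)"
proof -
  have "cycle_weight a (us @ x # vs @ x # ws) = cycle_weight a (x # vs @ x # ws @ us)"
    using cycle_weight_rotate[of a us "x # vs @ x # ws"] by simp
  also have "\<dots> = cycle_weight a (x # vs) * cycle_weight a (x # ws @ us)"
    using path_weight_append2[of a x vs x "ws @ us @ [x]"] by (simp add: cycle_weight_def)
  also have "cycle_weight a (x # ws @ us) = cycle_weight a (us @ x # ws)"
    using cycle_weight_rotate[of a us "x # ws"] by simp
  finally show ?thesis by (simp add: mult.commute)
qed

text \<open>Cut at \<open>v\<close>, both sides consist of the same four paths: two from
  \<open>p\<close> to \<open>v\<close> and two from \<open>v\<close> back to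
  \<open>p\<close>.\<close>

lemma cycle_weight_swap_tails:
  "cycle_weight a (p # ps @ us @ v # ys) * cycle_weight a (p # ps @ v # zs) =
   cycle_weight a (p # ps @ v # ys) * cycle_weight a (p # ps @ us @ v # zs)"
  using path_weight_append2[of a p "ps @ us" v "ys @ [p]"] path_weight_append2[of a p ps v "zs @ [p]"]
    path_weight_append2[of a p ps v "ys @ [p]"] path_weight_append2[of a p "ps @ us" v "zs @ [p]"]
  by (simp add: cycle_weight_def ac_simps)

lemma path_weight_orbit:
  "path_weight a (map (\<lambda>i. (p ^^ i) x) [0..<Suc k]) = (\<Prod>i<k. a ((p ^^ i) x) (p ((p ^^ i) x)))"
proof (induction k)
  case (Suc k)
  show ?case
    using Suc path_weight_append[of a "map (\<lambda>i. (p ^^ i) x) [0..<k]" "(p ^^ k) x" "[p ((p ^^ k) x)]"]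
    by simp
qed simp

text \<open>Here \<open>support p x\<close> is the list of the orbit of \<open>x\<close> in the
  order in which \<open>p\<close> runs through it. Its entries are distinct, so the product along
  the list is a product over its set.\<close>

lemma cycle_weight_support:
  assumes "permutation p"
  shows "cycle_weight a (support p x) = (\<Prod>i\<in>set (support p x). a i (p i))"
proof -
  let ?k = "least_power p x"
  have k: "(p ^^ ?k) x = x" "?k > 0" by (rule least_power_of_permutation[OF assms])+
  have "hd (support p x) = x" using k(2) by (simp add: hd_map)
  then have "support p x @ [hd (support p x)] = map (\<lambda>i. (p ^^ i) x) [0..<Suc ?k]"
    using k(1) by simp
  then have "cycle_weight a (support p x) = (\<Prod>i<?k. a ((p ^^ i) x) (p ((p ^^ i) x)))"
    unfolding cycle_weight_def using path_weight_orbit by metis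
  also have "\<dots> = (\<Prod>i\<in>set (support p x). a i (p i))"
  proof -
    have "inj_on (\<lambda>i. (p ^^ i) x) {..<?k}"
      using cycle_of_permutation[OF assms, of x] by (simp add: distinct_map atLeast0LessThan)
    then show ?thesis by (simp add: prod.reindex atLeast0LessThan)
  qed
  finally show ?thesis .
qed

lemma support_cycle_of_list:
  assumes "distinct xs" "xs \<noteq> []"
  shows "support (cycle_of_list xs) (hd xs) = xs"
proof -
  let ?p = "cycle_of_list xs" and ?x = "hd xs"
  have nth: "(?p ^^ i) ?x = xs ! (i mod length xs)" for i
  proof -
    have "(?p ^^ i) ?x = hd (map (?p ^^ i) xs)" using assms(2) by (simp add: hd_map)
    also have "\<dots> = hd (rotate i xs)" by (simp add: cyclic_rotation[OF assms(1)])
    finally show ?thesis using hd_rotate_conv_nth[OF assms(2)] by simp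
  qed
  have "least_power ?p ?x = length xs"
    unfolding least_power_def
  proof (rule Least_equality)
    show "(?p ^^ length xs) ?x = ?x \<and> 0 < length xs"
      using assms(2) nth[of "length xs"] by (simp add: hd_conv_nth)
    fix k assume k: "(?p ^^ k) ?x = ?x \<and> 0 < k"
    show "length xs \<le> k"
    proof (rule ccontr)
      assume "\<not> length xs \<le> k"
      then have "xs ! k = xs ! 0" "k < length xs"
        using k nth[of k] assms(2) by (auto simp: hd_conv_nth)
      then show False using k nth_eq_iff_index_eq[OF assms(1), of k 0] assms(2) by simp
    qed
  qed
  then show ?thesis by (intro nth_equalityI) (auto simp: nth)
qed

lemma permutes_eq_cycle_of_list:
  assumes "q permutes set (support q x)" "permutation q"
  shows "q = cycle_of_list (support q x)"
proof
  fix y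
  show "q y = cycle_of_list (support q x) y"
  proof (cases "y \<in> set (support q x)")
    case True
    then show ?thesis by (rule cycle_restrict[OF assms(2)])
  next
    case False
    then show ?thesis using permutes_not_in[OF assms(1)] id_outside_supp by metis
  qed
qed

definition perm_weight :: "('v \<Rightarrow> 'v \<Rightarrow> 'r::comm_ring_1) \<Rightarrow> 'v set \<Rightarrow> ('v \<Rightarrow> 'v) \<Rightarrow> 'r" where
  "perm_weight a I p = (\<Prod>i\<in>I. a i (p i))"

lemma support_subset:
  assumes "p permutes I" "finite I" "x \<in> I"
  shows "set (support p x) \<subseteq> I"
  using assms(3) permutes_in_image[OF permutes_funpow[OF assms(1)]] by auto

text \<open>Splits off the cycle through \<open>x\<close>. The rest of \<open>p\<close> is extended
  by the identity outside \<open>J\<close>, so that it permutes \<open>J\<close> and inductions on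
  the index set apply to it.\<close>

lemma perm_weight_decompose:
  assumes "p permutes I" "finite I" "x \<in> I"
  defines "J \<equiv> I - set (support p x)"
  shows "perm_weight a I p =
    cycle_weight a (support p x) * perm_weight a J (\<lambda>y. if y \<in> J then p y else y)"
proof -
  have p: "permutation p" using assms by (auto simp: permutation_permutes)
  have "perm_weight a I p = (\<Prod>i\<in>set (support p x). a i (p i)) * (\<Prod>i\<in>J. a i (p i))"
    unfolding perm_weight_def J_def
    by (subst prod.subset_diff[OF support_subset[OF assms(1-3)] assms(2)]) (rule mult.commute)
  also have "(\<Prod>i\<in>J. a i (p i)) = perm_weight a J (\<lambda>y. if y \<in> J then p y else y)"
    unfolding perm_weight_def by (rule prod.cong) auto
  finally show ?thesis by (simp add: cycle_weight_support[OF p])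
qed

lemma permutes_decompose:
  fixes x :: 'v
  assumes "p permutes I" "finite I"
  defines "J \<equiv> I - set (support p x)"
  shows "(\<lambda>y. if y \<in> J then p y else y) permutes J"
  using semidecomposition[OF assms(1,2)] unfolding J_def .

lemma hd_support:
  assumes "permutation p"
  shows "hd (support p x) = x" "support p x \<noteq> []"
  using least_power_of_permutation(2)[OF assms, of x] by (simp_all add: hd_map)

subsection \<open>Integrality of cycle weights over principal minors\<close>

lemma (in partial_hom) integral_Domain:
  assumes "d \<in> Domain H"
  shows "integral_over (Domain H) d"
  unfolding integral_over_def using span_base[of "{1}" 1 d] assms by (intro exI[of _ "{1}"]) simp

text \<open>The lists are cut after their longest common prefix; \<open>v\<close> is the next vertex
  of \<open>ys\<close>, which must occur later in \<open>xs\<close>. Equal heads make the prefix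
  nonempty, and the differing next vertices make \<open>us\<close> nonempty.\<close>

lemma ex_decomposition_distinct_lists:
  assumes "distinct xs" "distinct ys" "set xs = set ys" "hd xs = hd ys" "xs \<noteq> ys"
  obtains p ps us v ws zs where "xs = p # ps @ us @ v # ws" "ys = p # ps @ v # zs" "us \<noteq> []"
proof -
  have len: "length xs = length ys" using assms(1-3) distinct_card by metis
  obtain qs xs' ys' where d: "xs = qs @ xs'" "ys = qs @ ys'" "xs' = [] \<or> ys' = [] \<or> hd xs' \<noteq> hd ys'"
    using longest_common_prefix by metis
  then have ne: "xs' \<noteq> []" "ys' \<noteq> []" "hd xs' \<noteq> hd ys'" using len assms(5) by auto
  then obtain v zs where ys': "ys' = v # zs" by (cases ys') auto
  have "v \<in> set xs'" using assms(2,3) d ys' by auto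
  then obtain us ws where xs': "xs' = us @ v # ws" by (meson split_list)
  have "us \<noteq> []" using ne(3) xs' ys' by auto
  moreover have "qs \<noteq> []" using assms(4) ne d by auto
  then obtain p ps where "qs = p # ps" by (cases qs) auto
  ultimately show ?thesis using that d xs' ys' by simp
qed

text \<open>The state of the induction on length: closed walks with fewer than \<open>m\<close>
  steps already have values, and those with \<open>m\<close> steps are to be treated.\<close>

locale weighted_cycles = partial_hom H for H :: "('r::comm_ring_1 \<times> complex) set" +
  fixes a :: "'v \<Rightarrow> 'v \<Rightarrow> 'r" and V :: "'v set" and m :: nat
  assumes finite_V: "finite V"
    and short: "xs \<noteq> [] \<Longrightarrow> set xs \<subseteq> V \<Longrightarrow> length xs < m \<Longrightarrow> cycle_weight a xs \<in> Domain H"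
begin

lemma perm_weight_short:
  assumes "p permutes J" "J \<subseteq> V" "card J < m"
  shows "perm_weight a J p \<in> Domain H"
  using assms
proof (induction "card J" arbitrary: J p rule: less_induct)
  case less
  have fin: "finite J" using less.prems(2) finite_V by (rule finite_subset)
  show ?case
  proof (cases "J = {}")
    case True
    then show ?thesis by (simp add: perm_weight_def Domain_1)
  next
    case False
    then obtain x where x: "x \<in> J" by blast
    let ?S = "set (support p x)"
    have p: "permutation p" using less.prems(1) fin by (auto simp: permutation_permutes)
    have sub: "?S \<subseteq> J" by (rule support_subset[OF less.prems(1) fin x])
    have "x \<in> ?S" using hd_support[OF p] list.set_sel(1) by metis
    then have lt: "card (J - ?S) < card J" using x fin by (intro psubset_card_mono) auto
    have "length (support p x) = card ?S"
      using distinct_card[OF cycle_of_permutation[OF p, of x]] by simp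
    also have "\<dots> \<le> card J" using sub fin by (rule card_mono[rotated])
    finally have "cycle_weight a (support p x) \<in> Domain H"
      using less.prems sub hd_support(2)[OF p] by (intro short) auto
    moreover have "perm_weight a (J - ?S) (\<lambda>y. if y \<in> J - ?S then p y else y) \<in> Domain H"
      using less.prems lt permutes_decompose[OF less.prems(1) fin] by (intro less.hyps) auto
    ultimately show ?thesis
      using perm_weight_decompose[OF less.prems(1) fin x, of a] by (simp add: Domain_mult)
  qed
qed

text \<open>The fixed first vertex selects one list from each class of rotations, so different lists
  are different cycles.\<close>

definition full_cycles :: "'v set \<Rightarrow> 'v \<Rightarrow> 'v list set" where
  "full_cycles I x = {ys. distinct ys \<and> set ys = I \<and> hd ys = x}"

definition gens :: "'v set \<Rightarrow> 'v \<Rightarrow> 'r set" where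
  "gens I x = insert 1 (cycle_weight a ` full_cycles I x)"

lemma finite_gens:
  assumes "finite I"
  shows "finite (gens I x)"
proof -
  have "full_cycles I x \<subseteq> {ys. set ys \<subseteq> I \<and> length ys = card I}"
    unfolding full_cycles_def by (auto simp: distinct_card)
  then show ?thesis
    unfolding gens_def using finite_lists_length_eq[OF assms] finite_subset by blast
qed

lemma Domain_subset_span:
  assumes "finite I" "d \<in> Domain H"
  shows "d \<in> span_over (Domain H) (gens I x)"
  using span_base[OF finite_gens[OF assms(1)] _ assms(2), of 1 x] by (simp add: gens_def)

lemma full_cycle_in_span:
  assumes "finite I" "ys \<in> full_cycles I x"
  shows "cycle_weight a ys \<in> span_over (Domain H) (gens I x)"
  using span_base[OF finite_gens[OF assms(1)] _ Domain_1, of "cycle_weight a ys" x] assms(2)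
  by (simp add: gens_def)

text \<open>At a repeated vertex the walk splits in two. By the bound \<open>2 * m\<close> one part
  has fewer than \<open>m\<close> steps, so it is a scalar from the domain, and the other part is
  covered by induction. A walk without repetition and with at least \<open>m\<close> steps visits
  all of \<open>I\<close> and rotates to a full cycle.\<close>

lemma cycle_weight_in_span:
  assumes "I \<subseteq> V" "card I = m" "x \<in> I" "xs \<noteq> []" "set xs \<subseteq> I" "length xs < 2 * m"
  shows "cycle_weight a xs \<in> span_over (Domain H) (gens I x)"
  using assms(4-)
proof (induction "length xs" arbitrary: xs rule: less_induct)
  case less
  have fin: "finite I" using assms(1) finite_V by (rule finite_subset)
  show ?case
  proof (cases "length xs < m")
    case True
    then show ?thesis using less.prems assms(1) by (intro Domain_subset_span[OF fin] short) auto
  next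
    case long: False
    show ?thesis
    proof (cases "distinct xs")
      case True
      then have "set xs = I"
        using less.prems long assms(2) distinct_card[OF True] card_seteq[OF fin, of "set xs"] by simp
      then obtain us vs where xs: "xs = us @ x # vs" using assms(3) by (metis split_list)
      have "x # vs @ us \<in> full_cycles I x"
        using True \<open>set xs = I\<close> unfolding full_cycles_def xs by auto
      then have "cycle_weight a ((x # vs) @ us) \<in> span_over (Domain H) (gens I x)"
        using full_cycle_in_span[OF fin] by simp
      then show ?thesis unfolding xs cycle_weight_rotate[of a us] .
    next
      case False
      then obtain us y vs ws where "xs = us @ [y] @ vs @ [y] @ ws"
        using not_distinct_decomp by blast
      then have xs: "xs = us @ y # vs @ y # ws" by simp
      let ?l1 = "us @ y # ws" and ?l2 = "y # vs"
      have IH: "cycle_weight a ?l1 \<in> span_over (Domain H) (gens I x)"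
        "cycle_weight a ?l2 \<in> span_over (Domain H) (gens I x)"
        using less.prems by (auto intro!: less.hyps simp: xs)
      have D: "cycle_weight a l \<in> Domain H" if "l \<noteq> []" "set l \<subseteq> I" "length l < m" for l
        using that assms(1) by (intro short) auto
      have "length ?l1 < m \<or> length ?l2 < m" using less.prems(3) by (auto simp: xs)
      then show ?thesis
      proof
        assume "length ?l1 < m"
        then have "cycle_weight a ?l1 \<in> Domain H" using less.prems by (intro D) (auto simp: xs)
        then show ?thesis unfolding xs cycle_weight_split using span_scale[OF IH(2)] by simp
      next
        assume "length ?l2 < m"
        then have "cycle_weight a ?l2 \<in> Domain H" using less.prems by (intro D) (auto simp: xs)
        then show ?thesis unfolding xs cycle_weight_split mult.commute[of "cycle_weight a ?l1"]
          using span_scale[OF IH(1)] by simp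
      qed
    qed
  qed
qed

text \<open>Exchanging the tails of two different cycles through the same vertices, at a vertex
  where the second leaves the first, gives a closed walk that is too short and one that is
  too long to be a cycle through all these vertices.\<close>

lemma full_cycles_product_in_span:
  assumes "I \<subseteq> V" "card I = m" "x \<in> I"
    and "xs \<in> full_cycles I x" "ys \<in> full_cycles I x" "xs \<noteq> ys"
  shows "cycle_weight a xs * cycle_weight a ys \<in> span_over (Domain H) (gens I x)"
proof -
  have fc: "distinct xs" "distinct ys" "set xs = I" "set ys = I" "hd xs = hd ys"
    using assms(4,5) unfolding full_cycles_def by auto
  then obtain p ps us v ws zs where d: "xs = p # ps @ us @ v # ws" "ys = p # ps @ v # zs" "us \<noteq> []"
    using assms(6) by (metis ex_decomposition_distinct_lists)
  have len: "length xs = m" "length ys = m" using fc assms(2) distinct_card by metis+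
  have "cycle_weight a (p # ps @ v # ws) \<in> Domain H"
    using fc(3) assms(1) len d by (intro short) auto
  \<comment> \<open>The inserted \<open>us\<close> is a proper part of \<open>xs\<close>, so the
    longer walk still has fewer than \<open>2 * m\<close> steps.\<close>
  moreover have "cycle_weight a (p # ps @ us @ v # zs) \<in> span_over (Domain H) (gens I x)"
    using fc(3,4) len d by (intro cycle_weight_in_span[OF assms(1-3)]) auto
  ultimately show ?thesis
    unfolding d(1,2) cycle_weight_swap_tails using span_scale by blast
qed

text \<open>Either \<open>p\<close> is a single cycle through \<open>I\<close>, different from
  \<open>xs\<close>, and two different full cycles are multiplied; or all cycles of \<open>p\<close>
  have fewer than \<open>m\<close> steps, and its weight is a scalar from the domain.\<close>

lemma perm_weight_times_cycle_in_span:
  assumes "I \<subseteq> V" "card I = m" "x \<in> I" "xs \<in> full_cycles I x"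
    and "p permutes I" "p \<noteq> cycle_of_list xs"
  shows "perm_weight a I p * cycle_weight a xs \<in> span_over (Domain H) (gens I x)"
proof -
  let ?S = "set (support p x)"
  have fin: "finite I" using assms(1) finite_V by (rule finite_subset)
  have p: "permutation p" using assms(5) fin by (auto simp: permutation_permutes)
  have sub: "?S \<subseteq> I" by (rule support_subset[OF assms(5) fin assms(3)])
  have dec: "perm_weight a I p =
      cycle_weight a (support p x) * perm_weight a (I - ?S) (\<lambda>y. if y \<in> I - ?S then p y else y)"
    by (rule perm_weight_decompose[OF assms(5) fin assms(3)])
  show ?thesis
  proof (cases "?S = I")
    case True
    have "support p x \<in> full_cycles I x"
      using cycle_of_permutation[OF p] True hd_support(1)[OF p] unfolding full_cycles_def by blast
    moreover have "support p x \<noteq> xs"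
      using permutes_eq_cycle_of_list[of p x] assms(5,6) p True by auto
    moreover have "perm_weight a I p = cycle_weight a (support p x)"
      unfolding dec True by (simp add: perm_weight_def)
    ultimately show ?thesis
      using full_cycles_product_in_span[OF assms(1-3) _ assms(4)] by simp
  next
    case False
    have "x \<in> ?S" using hd_support[OF p] list.set_sel(1) by metis
    then have lt: "card (I - ?S) < m" unfolding assms(2)[symmetric]
      using assms(3) fin by (intro psubset_card_mono) auto
    have "card ?S < m"
      unfolding assms(2)[symmetric] using sub False fin by (intro psubset_card_mono) auto
    then have "length (support p x) < m"
      using distinct_card[OF cycle_of_permutation[OF p, of x]] by simp
    then have "cycle_weight a (support p x) \<in> Domain H"
      using sub assms(1) hd_support(2)[OF p] by (intro short) auto
    moreover have "perm_weight a (I - ?S) (\<lambda>y. if y \<in> I - ?S then p y else y) \<in> Domain H"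
      using lt assms(1) permutes_decompose[OF assms(5) fin] by (intro perm_weight_short) auto
    ultimately have "perm_weight a I p \<in> Domain H"
      unfolding dec by (rule Domain_mult)
    then show ?thesis by (intro span_scale full_cycle_in_span[OF fin assms(4)])
  qed
qed

text \<open>The module spanned by \<open>gens I x\<close> is stable under \<open>c\<close>:
  \<open>1\<close> goes to \<open>c\<close>, other full cycles are handled by exchanging tails, and
  \<open>c * c\<close> is reached by solving the minor for the one term belonging to the cycle
  \<open>xs\<close>. The signs enter only through being \<open>1\<close> or
  \<open>-1\<close>.\<close>

lemma integral_cycle_weight:
  assumes xs: "distinct xs" "xs \<noteq> []" "set xs \<subseteq> V" "length xs = m"
    and s: "\<And>p. s p \<in> {1, - 1 :: int}"
    and minor: "(\<Sum>p | p permutes set xs. of_int (s p) * perm_weight a (set xs) p) \<in> Domain H"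
  shows "integral_over (Domain H) (cycle_weight a xs)"
proof -
  define I x c where "I = set xs" and "x = hd xs" and "c = cycle_weight a xs"
  let ?span = "span_over (Domain H) (gens I x)"
  have I: "I \<subseteq> V" "card I = m" "x \<in> I" "finite I"
    using xs distinct_card[OF xs(1)] unfolding I_def x_def by auto
  have full: "xs \<in> full_cycles I x"
    using xs(1) unfolding full_cycles_def I_def x_def by simp
  have c: "c \<in> ?span" unfolding c_def by (rule full_cycle_in_span[OF I(4) full])
  have sD: "of_int (s p) \<in> Domain H" for p using sign[OF s] by blast
  define p0 where "p0 = cycle_of_list xs"
  have p0: "p0 permutes I" unfolding p0_def I_def by (rule cycle_permutes)
  have wp0: "perm_weight a I p0 = c"
    using cycle_weight_support[OF permutation_of_cycle[of xs], of a x]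
    unfolding p0_def c_def perm_weight_def x_def support_cycle_of_list[OF xs(1,2)] I_def by simp
  define M where "M = (\<Sum>p | p permutes I. of_int (s p) * perm_weight a I p)"
  define R where "R = (\<Sum>p \<in> {p. p permutes I} - {p0}. of_int (s p) * perm_weight a I p)"
  have "M = of_int (s p0) * c + R"
    unfolding M_def R_def using sum.remove[OF finite_permutations[OF I(4)], of p0 "\<lambda>p. of_int (s p) * perm_weight a I p"] p0 wp0 by simp
  then have "of_int (s p0) * c = M - R" by simp
  then have "of_int (s p0) * (of_int (s p0) * c) = of_int (s p0) * (M - R)" by simp
  \<comment> \<open>The sign is its own inverse. After multiplication by \<open>c\<close>, the part
    \<open>M * c\<close> is a scalar times a generator and \<open>R * c\<close> consists of products
    with permutations other than \<open>p0\<close>.\<close>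
  then have "c = of_int (s p0) * (M + (- 1) * R)"
    using s[of p0] by auto
  then have "c * c = of_int (s p0) * (M * c + (- 1) * (R * c))"
    by (metis (no_types, lifting) distrib_right mult.assoc)
  moreover have Mc: "M * c \<in> ?span"
    using minor unfolding M_def I_def[symmetric] by (rule span_scale[OF c])
  moreover have Rc: "R * c \<in> ?span"
    unfolding R_def sum_distrib_right mult.assoc c_def
    by (intro span_sum span_scale sD perm_weight_times_cycle_in_span I full) (auto simp: p0_def)
  ultimately have cc: "c * c \<in> ?span"
    by (simp only:) (rule span_scale[OF span_add[OF Mc span_scale[OF Rc Domain_uminus[OF Domain_1]]] sD])
  have "c * g \<in> ?span" if g: "g \<in> gens I x" for g
  proof -
    consider "g = 1" | ys where "ys \<in> full_cycles I x" "g = cycle_weight a ys" "ys \<noteq> xs" | "g = c"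
      using g unfolding gens_def c_def by blast
    then show ?thesis
      using c cc full_cycles_product_in_span[OF I(1-3) full] by cases (auto simp: c_def)
  qed
  then show ?thesis
    unfolding integral_over_def c_def[symmetric] using finite_gens[OF I(4)]
    by (intro exI[of _ "gens I x"]) (auto simp: gens_def)
qed

end

text \<open>Each stage adjoins the finitely many weights of walks with exactly \<open>m\<close>
  steps. With a repeated vertex such a walk factors into shorter ones; otherwise its weight is
  integral by the minor on its vertex set.\<close>

lemma Domain_cycle_weight_extend:
  fixes a :: "'v \<Rightarrow> 'v \<Rightarrow> 'r::comm_ring_1"
  assumes "finite V" "partial_hom H"
    and "\<And>I. I \<subseteq> V \<Longrightarrow> \<exists>s. (\<forall>p. s p \<in> {1, - 1 :: int}) \<and>
      (\<Sum>p | p permutes I. of_int (s p) * perm_weight a I p) \<in> Domain H"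
  shows "\<exists>H'. partial_hom H' \<and> H \<subseteq> H' \<and>
    (\<forall>xs. xs \<noteq> [] \<longrightarrow> set xs \<subseteq> V \<longrightarrow> length xs < m \<longrightarrow> cycle_weight a xs \<in> Domain H')"
proof (induction m)
  case 0
  then show ?case using assms(2) by auto
next
  case (Suc m)
  then obtain H1 where H1: "partial_hom H1" "H \<subseteq> H1"
    and short: "\<And>xs. xs \<noteq> [] \<Longrightarrow> set xs \<subseteq> V \<Longrightarrow> length xs < m \<Longrightarrow> cycle_weight a xs \<in> Domain H1"
    by blast
  interpret partial_hom H1 by fact
  interpret weighted_cycles H1 a V m using assms(1) short by unfold_locales auto
  define L where "L = {xs. set xs \<subseteq> V \<and> length xs = m}"
  have "integral_over (Domain H1) (cycle_weight a xs)" if xs: "xs \<in> L - {[]}" for xs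
  proof (cases "distinct xs")
    case True
    obtain s where s: "\<And>p. s p \<in> {1, - 1 :: int}"
      "(\<Sum>p | p permutes set xs. of_int (s p) * perm_weight a (set xs) p) \<in> Domain H"
      using assms(3)[of "set xs"] xs unfolding L_def by auto
    then show ?thesis
      using xs True H1(2) unfolding L_def by (intro integral_cycle_weight[of xs s]) auto
  next
    case False
    then obtain us y vs ws where "xs = us @ [y] @ vs @ [y] @ ws"
      using not_distinct_decomp by blast
    then have d: "xs = us @ y # vs @ y # ws" by simp
    have "cycle_weight a xs \<in> Domain H1"
      unfolding d cycle_weight_split using xs d unfolding L_def by (intro Domain_mult short) auto
    then show ?thesis by (rule integral_Domain)
  qed
  moreover have "finite (cycle_weight a ` (L - {[]}))"
    unfolding L_def using finite_lists_length_eq[OF assms(1)] by simp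
  ultimately obtain H2 where H2: "partial_hom H2" "H1 \<subseteq> H2" "cycle_weight a ` (L - {[]}) \<subseteq> Domain H2"
    using extend_finite_integral[OF _ H1(1), of "cycle_weight a ` (L - {[]})"] by blast
  have "cycle_weight a xs \<in> Domain H2" if "xs \<noteq> []" "set xs \<subseteq> V" "length xs < Suc m" for xs
  proof (cases "length xs = m")
    case True
    then have "xs \<in> L - {[]}" using that unfolding L_def by auto
    then show ?thesis using H2(3) by blast
  next
    case False
    then show ?thesis using short[of xs] that H2(2) by auto
  qed
  then show ?case using H1(2) H2 by (intro exI[of _ H2]) blast
qed

text \<open>Walks with at most \<open>card V\<close> steps suffice, since a longer one repeats a
  vertex and factors.\<close>

lemma Domain_all_cycle_weights_extend:
  fixes a :: "'v \<Rightarrow> 'v \<Rightarrow> 'r::comm_ring_1"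
  assumes "finite V" "partial_hom H"
    and "\<And>I. I \<subseteq> V \<Longrightarrow> \<exists>s. (\<forall>p. s p \<in> {1, - 1 :: int}) \<and>
      (\<Sum>p | p permutes I. of_int (s p) * perm_weight a I p) \<in> Domain H"
  shows "\<exists>H'. partial_hom H' \<and> H \<subseteq> H' \<and>
    (\<forall>xs. xs \<noteq> [] \<longrightarrow> set xs \<subseteq> V \<longrightarrow> cycle_weight a xs \<in> Domain H')"
proof -
  obtain H' where H': "partial_hom H'" "H \<subseteq> H'" and short:
    "\<And>xs. xs \<noteq> [] \<Longrightarrow> set xs \<subseteq> V \<Longrightarrow> length xs < Suc (card V) \<Longrightarrow> cycle_weight a xs \<in> Domain H'"
    using Domain_cycle_weight_extend[OF assms(1,2), of a "Suc (card V)"] assms(3) by auto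
  have "cycle_weight a xs \<in> Domain H'" if "xs \<noteq> []" "set xs \<subseteq> V" for xs
    using that
  proof (induction "length xs" arbitrary: xs rule: less_induct)
    case less
    show ?case
    proof (cases "distinct xs")
      case True
      then have "length xs \<le> card V"
        using distinct_card[OF True] card_mono[OF assms(1) less.prems(2)] by simp
      then show ?thesis using less.prems short[of xs] by simp
    next
      case False
      then obtain us y vs ws where "xs = us @ [y] @ vs @ [y] @ ws"
        using not_distinct_decomp by blast
      then have d: "xs = us @ y # vs @ y # ws" by simp
      show ?thesis
        unfolding d cycle_weight_split using less.prems unfolding d
        by (intro partial_hom.Domain_mult[OF H'(1)] less.hyps) (auto simp: d)
    qed
  qed
  then show ?thesis using H' by blast
qed

subsection \<open>Matrices with prescribed cycle weights\<close>

lemma path_weight_eq_0: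
  assumes "\<not> successively (\<lambda>i j. b i j \<noteq> 0) xs"
  shows "path_weight b xs = 0"
  using assms by (induction b xs rule: path_weight.induct) auto

lemma not_successively_split:
  assumes "\<not> successively R xs"
  obtains us x y vs where "xs = us @ x # y # vs" "\<not> R x y"
proof -
  have "\<exists>us x y vs. xs = us @ x # y # vs \<and> \<not> R x y"
    using assms
  proof (induction xs rule: induct_list012)
    case (3 x y zs)
    show ?case
    proof (cases "R x y")
      case True
      then obtain us x' y' vs where "y # zs = us @ x' # y' # vs" "\<not> R x' y'"
        using 3 by auto
      then show ?thesis by (metis append_Cons)
    next
      case False
      then show ?thesis by (metis append_Nil)
    qed
  qed auto
  then show ?thesis using that by blast
qed

text \<open>Walks with different ends need not have a value under the homomorphism; they are used
  only in products that close up. The one-vertex walk supplies \<open>1\<close>.\<close>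

definition walk_weights :: "('v \<Rightarrow> 'v \<Rightarrow> 'r::comm_ring_1) \<Rightarrow> 'v set \<Rightarrow> 'v \<Rightarrow> 'v \<Rightarrow> 'r set" where
  "walk_weights a V u v = {path_weight a xs | xs. xs \<noteq> [] \<and> set xs \<subseteq> V \<and> hd xs = u \<and> last xs = v}"

lemma walk_weightsI:
  "xs \<noteq> [] \<Longrightarrow> set xs \<subseteq> V \<Longrightarrow> hd xs = u \<Longrightarrow> last xs = v \<Longrightarrow> path_weight a xs \<in> walk_weights a V u v"
  unfolding walk_weights_def by blast

lemma walk_weights_refl: "u \<in> V \<Longrightarrow> 1 \<in> walk_weights a V u u"
  using walk_weightsI[of "[u]" V u u a] by simp

lemma walk_weights_edge: "u \<in> V \<Longrightarrow> v \<in> V \<Longrightarrow> a u v \<in> walk_weights a V u v"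
  using walk_weightsI[of "[u, v]" V u v a] by simp

lemma walk_weights_trans:
  assumes "f \<in> walk_weights a V u v" "g \<in> walk_weights a V v w"
  shows "f * g \<in> walk_weights a V u w"
proof -
  obtain xs ys where xs: "xs \<noteq> []" "set xs \<subseteq> V" "hd xs = u" "last xs = v" "f = path_weight a xs"
    and ys: "ys \<noteq> []" "set ys \<subseteq> V" "hd ys = v" "last ys = w" "g = path_weight a ys"
    using assms unfolding walk_weights_def by blast
  obtain xs' where xs': "xs = xs' @ [v]" using xs by (metis append_butlast_last_id)
  obtain ys' where ys': "ys = v # ys'" using ys by (metis list.collapse)
  have "f * g = path_weight a (xs' @ ys)"
    unfolding xs(5) ys(5) xs' ys' by (rule path_weight_append[symmetric])
  also have "\<dots> \<in> walk_weights a V u w"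
    using xs ys unfolding xs' ys' by (intro walk_weightsI) (auto simp: hd_append)
  finally show ?thesis .
qed

text \<open>The matrix is found by calling \<open>i\<close> and \<open>j\<close> related when some closed walk through both has
  nonzero value, fixing walks \<open>P i\<close> and \<open>Q i\<close> from and to a root of the class of \<open>i\<close> whose product
  has nonzero value, and dividing the value of \<open>P i * a i j * Q j\<close> by that of \<open>P j * Q j\<close>.\<close>

lemma (in partial_hom) realize_cycle_weights:
  assumes cyc: "\<And>xs. xs \<noteq> [] \<Longrightarrow> set xs \<subseteq> V \<Longrightarrow> cycle_weight a xs \<in> Domain H"
  shows "\<exists>b. \<forall>xs. xs \<noteq> [] \<longrightarrow> set xs \<subseteq> V \<longrightarrow> (cycle_weight a xs, cycle_weight b xs) \<in> H"
proof -
  let ?W = "walk_weights a V"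
  \<comment> \<open>Outside \<open>Domain H\<close> this choice is arbitrary, so each use of
    multiplicativity is justified by \<open>D\<close>, which puts closed walks in the
    domain.\<close>
  define \<phi> where "\<phi> f = (SOME z. (f, z) \<in> H)" for f
  have \<phi>: "(f, \<phi> f) \<in> H" if "f \<in> Domain H" for f
    using that unfolding \<phi>_def by (meson Domain_iff someI_ex)
  have \<phi>_mult: "\<phi> (f * g) = \<phi> f * \<phi> g" if "f \<in> Domain H" "g \<in> Domain H" for f g
    using unique[OF \<phi>[OF Domain_mult[OF that]] mult[OF \<phi>[OF that(1)] \<phi>[OF that(2)]]] .
  have \<phi>_1: "\<phi> 1 = 1" using unique[OF \<phi>[OF Domain_1] one] .
  have D: "f \<in> Domain H" if f: "f \<in> ?W u u" for u f
  proof -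
    obtain xs where xs: "xs \<noteq> []" "set xs \<subseteq> V" "hd xs = u" "last xs = u" "f = path_weight a xs"
      using f unfolding walk_weights_def by blast
    obtain ys where ys: "xs = ys @ [u]" using xs by (metis append_butlast_last_id)
    show ?thesis
    proof (cases "ys = []")
      case True
      then show ?thesis using xs ys Domain_1 by simp
    next
      case False
      then have "f = cycle_weight a ys" using xs ys unfolding cycle_weight_def by simp
      then show ?thesis using cyc[OF False] xs ys by simp
    qed
  qed
  define E where "E i j \<longleftrightarrow> (\<exists>f\<in>?W i j. \<exists>g\<in>?W j i. \<phi> (f * g) \<noteq> 0)" for i j
  have E_refl: "E i i" if "i \<in> V" for i
    using walk_weights_refl[OF that, of a] \<phi>_1 unfolding E_def by (metis mult_1 zero_neq_one)
  have E_sym: "E j i" if "E i j" for i j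
    using that unfolding E_def by (metis mult.commute)
  have E_trans: "E i k" if ij: "E i j" and jk: "E j k" for i j k
  proof -
    obtain f g f' g' where f: "f \<in> ?W i j" "g \<in> ?W j i" "\<phi> (f * g) \<noteq> 0"
      "f' \<in> ?W j k" "g' \<in> ?W k j" "\<phi> (f' * g') \<noteq> 0"
      using ij jk unfolding E_def by blast
    have "\<phi> ((f * f') * (g' * g)) = \<phi> ((f * g) * (f' * g'))" by (simp add: ac_simps)
    also have "\<dots> \<noteq> 0"
      using f(3,6) \<phi>_mult[OF D[OF walk_weights_trans[OF f(1,2)]] D[OF walk_weights_trans[OF f(4,5)]]]
      by simp
    finally show ?thesis
      unfolding E_def using walk_weights_trans[OF f(1) f(4)] walk_weights_trans[OF f(5) f(2)] by blast
  qed
  define root where "root i = (SOME j. E i j)" for i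
  have root_eq: "root i = root j" if "E i j" for i j
  proof -
    \<comment> \<open>Related vertices have the same predicate, hence \<open>SOME\<close> chooses
      the same root for both.\<close>
    have "E i = E j" using that E_sym E_trans by blast
    then show ?thesis unfolding root_def by simp
  qed
  have "\<exists>f g. f \<in> ?W (root i) i \<and> g \<in> ?W i (root i) \<and> \<phi> (f * g) \<noteq> 0" if "i \<in> V" for i
    using E_sym[OF someI[of "E i", OF E_refl[OF that]]] unfolding root_def[symmetric] E_def by blast
  then obtain P Q where PQ: "\<And>i. i \<in> V \<Longrightarrow> P i \<in> ?W (root i) i" "\<And>i. i \<in> V \<Longrightarrow> Q i \<in> ?W i (root i)"
    "\<And>i. i \<in> V \<Longrightarrow> \<phi> (P i * Q i) \<noteq> 0"
    by metis
  \<comment> \<open>For related \<open>i\<close> and \<open>j\<close> the roots agree, so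
    \<open>P i * a i j * Q j\<close> is a closed walk at the root. The denominator removes the
    detour from \<open>j\<close> to the root and back, so that products of \<open>b\<close>
    telescope along walks.\<close>
  define b where "b i j = (if E i j then \<phi> (P i * a i j * Q j) / \<phi> (P j * Q j) else 0)" for i j
  have path: "\<phi> (P (hd xs) * path_weight a xs * Q (last xs)) =
      path_weight b xs * \<phi> (P (last xs) * Q (last xs)) \<and> root (hd xs) = root (last xs)"
    if "xs \<noteq> []" "set xs \<subseteq> V" "successively E xs" for xs
    using that
  proof (induction xs rule: induct_list012)
    case (3 u v us)
    let ?l = "last (v # us)" and ?w = "path_weight a (v # us)"
    have V: "u \<in> V" "v \<in> V" "?l \<in> V" "set (v # us) \<subseteq> V"
      using 3(4) last_in_set[of "v # us"] by (auto simp del: last.simps)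
    have E: "E u v" using 3(5) by simp
    have IH: "\<phi> (P v * ?w * Q ?l) = path_weight b (v # us) * \<phi> (P ?l * Q ?l)" "root v = root ?l"
      using 3 by auto
    have r: "root u = root v" using root_eq[OF E] .
    have in_W: "P u \<in> ?W (root v) u" "Q v \<in> ?W v (root v)" "P v \<in> ?W (root v) v"
      "Q ?l \<in> ?W ?l (root v)" "a u v \<in> ?W u v" "?w \<in> ?W v ?l"
      using PQ(1)[OF V(1)] PQ(2)[OF V(2)] PQ(1)[OF V(2)] PQ(2)[OF V(3)] V r IH(2) walk_weights_edge[of u V v a] walk_weightsI[of "v # us" V v ?l a]
      by (auto simp del: last.simps)
    note tr = walk_weights_trans
    \<comment> \<open>A detour through the root is inserted at \<open>v\<close>: the regrouped
      product separates the first step from the rest of the walk, and the nonzero factor is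
      cancelled at the end.\<close>
    have "\<phi> (P v * Q v) * \<phi> (P u * (a u v * ?w) * Q ?l) = \<phi> ((P v * Q v) * (P u * (a u v * ?w) * Q ?l))"
      by (rule \<phi>_mult[symmetric, OF D[OF tr[OF in_W(3) in_W(2)]]
        D[OF tr[OF tr[OF in_W(1) tr[OF in_W(5) in_W(6)]] in_W(4)]]])
    also have "\<dots> = \<phi> ((P u * a u v * Q v) * (P v * ?w * Q ?l))" by (simp add: ac_simps)
    also have "\<dots> = \<phi> (P u * a u v * Q v) * \<phi> (P v * ?w * Q ?l)"
      by (rule \<phi>_mult[OF D[OF tr[OF tr[OF in_W(1) in_W(5)] in_W(2)]]
        D[OF tr[OF tr[OF in_W(3) in_W(6)] in_W(4)]]])
    also have "\<dots> = \<phi> (P v * Q v) * (b u v * path_weight b (v # us) * \<phi> (P ?l * Q ?l))"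
      using IH(1) E PQ(3)[OF V(2)] unfolding b_def by simp
    finally show ?case using PQ(3)[OF V(2)] r IH(2) by simp
  qed (auto simp: mult.commute)
  have "(cycle_weight a xs, cycle_weight b xs) \<in> H" if xs: "xs \<noteq> []" "set xs \<subseteq> V" for xs
  proof -
    define h ys where "h = hd xs" and "ys = xs @ [h]"
    have h: "h \<in> V" using xs unfolding h_def by auto
    have ys: "ys \<noteq> []" "set ys \<subseteq> V" "hd ys = h" "last ys = h"
      using xs h unfolding ys_def h_def by auto
    have cw: "cycle_weight a xs = path_weight a ys" "cycle_weight b xs = path_weight b ys"
      unfolding cycle_weight_def ys_def h_def by (rule refl)+
    have in_W: "path_weight a ys \<in> ?W h h" using ys by (intro walk_weightsI) auto
    have "\<phi> (path_weight a ys) = path_weight b ys"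
    proof (cases "successively E ys")
      case True
      have "\<phi> (P h * Q h) * \<phi> (path_weight a ys) = \<phi> (P h * path_weight a ys * Q h)"
        using \<phi>_mult[OF D[OF walk_weights_trans[OF PQ(1,2)[OF h]]] D[OF in_W]]
        by (simp add: ac_simps)
      also have "\<dots> = path_weight b ys * \<phi> (P h * Q h)"
        using path[OF ys(1,2) True] ys by simp
      finally show ?thesis using PQ(3)[OF h] by simp
    next
      case False
      then obtain us x y vs where d: "ys = us @ x # y # vs" "\<not> E x y"
        by (rule not_successively_split)
      have "path_weight b ys = 0"
        using d by (intro path_weight_eq_0) (auto simp: b_def successively_append_iff)
      moreover have "\<phi> (path_weight a ys) = 0"
      proof -
        have "path_weight a ys = path_weight a (us @ [x]) * (a x y * path_weight a (y # vs))"
          unfolding d(1) by (subst path_weight_append) simp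
        also have "\<dots> = a x y * (path_weight a (y # vs) * path_weight a (us @ [x]))"
          by (simp add: ac_simps)
        finally have eq: "path_weight a ys = a x y * (path_weight a (y # vs) * path_weight a (us @ [x]))" .
        \<comment> \<open>The rest of the closed walk leads from \<open>y\<close> through
          \<open>h\<close> back to \<open>x\<close>. A nonzero value of the whole would therefore
          make \<open>x\<close> and \<open>y\<close> related.\<close>
        have "a x y \<in> ?W x y" using ys d by (intro walk_weights_edge) auto
        moreover have "path_weight a (y # vs) * path_weight a (us @ [x]) \<in> ?W y x"
          using ys d
          by (intro walk_weights_trans[of _ _ _ _ h] walk_weightsI) (auto simp: hd_append split: if_splits)
        ultimately show ?thesis
          using d(2) unfolding eq E_def by blast
      qed
      ultimately show ?thesis by simp
    qed
    then show ?thesis using \<phi>[OF D[OF in_W]] unfolding cw by simp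
  qed
  then show ?thesis by blast
qed

lemma (in partial_hom) realize_perm_weights:
  assumes cyc: "\<And>xs. xs \<noteq> [] \<Longrightarrow> set xs \<subseteq> V \<Longrightarrow> (cycle_weight a xs, cycle_weight b xs) \<in> H"
    and "p permutes I" "finite I" "I \<subseteq> V"
  shows "(perm_weight a I p, perm_weight b I p) \<in> H"
  using assms(2-)
proof (induction "card I" arbitrary: I p rule: less_induct)
  case less
  show ?case
  proof (cases "I = {}")
    case True
    then show ?thesis by (simp add: perm_weight_def one)
  next
    case False
    then obtain x where x: "x \<in> I" by blast
    let ?S = "set (support p x)"
    have p: "permutation p" using less.prems by (auto simp: permutation_permutes)
    have sub: "?S \<subseteq> I" by (rule support_subset[OF less.prems(1,2) x])
    have "x \<in> ?S" using hd_support[OF p] list.set_sel(1) by metis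
    then have "card (I - ?S) < card I" using x less.prems(2) by (intro psubset_card_mono) auto
    then have "(perm_weight a (I - ?S) (\<lambda>y. if y \<in> I - ?S then p y else y),
        perm_weight b (I - ?S) (\<lambda>y. if y \<in> I - ?S then p y else y)) \<in> H"
      using less.prems permutes_decompose[OF less.prems(1,2)] by (intro less.hyps) auto
    moreover have "(cycle_weight a (support p x), cycle_weight b (support p x)) \<in> H"
      using sub less.prems(3) hd_support(2)[OF p] by (intro cyc) auto
    ultimately show ?thesis
      unfolding perm_weight_decompose[OF less.prems(1,2) x] by (intro mult)
  qed
qed

subsection \<open>Evaluation of polynomials and expansion of minors\<close>

definition monomial_eval :: "('v \<Rightarrow>\<^sub>0 nat) \<Rightarrow> ('v \<Rightarrow> complex) \<Rightarrow> complex" where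
  "monomial_eval m x = (\<Prod>v\<in>Poly_Mapping.keys m. x v ^ Poly_Mapping.lookup m v)"

text \<open>Extra variables have exponent \<open>0\<close> and contribute the factor
  \<open>1\<close>, even where \<open>x\<close> vanishes. This allows a common index set for two
  monomials.\<close>

lemma monomial_eval_superset:
  assumes "finite S" "Poly_Mapping.keys m \<subseteq> S"
  shows "monomial_eval m x = (\<Prod>v\<in>S. x v ^ Poly_Mapping.lookup m v)"
  unfolding monomial_eval_def
  by (rule prod.mono_neutral_left) (use assms in \<open>auto simp: in_keys_iff\<close>)

lemma monomial_eval_add: "monomial_eval (m + m') x = monomial_eval m x * monomial_eval m' x"
proof -
  let ?S = "Poly_Mapping.keys m \<union> Poly_Mapping.keys m'"
  have "monomial_eval (m + m') x = (\<Prod>v\<in>?S. x v ^ Poly_Mapping.lookup (m + m') v)"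
    by (rule monomial_eval_superset) (use keys_add[of m m'] in auto)
  also have "\<dots> = (\<Prod>v\<in>?S. x v ^ Poly_Mapping.lookup m v) * (\<Prod>v\<in>?S. x v ^ Poly_Mapping.lookup m' v)"
    by (simp add: lookup_add power_add prod.distrib)
  finally show ?thesis
    using monomial_eval_superset[of ?S m x] monomial_eval_superset[of ?S m' x] by simp
qed

lemma poly_eval_superset:
  assumes "finite S" "Poly_Mapping.keys p \<subseteq> S"
  shows "poly_eval p x = (\<Sum>m\<in>S. Poly_Mapping.lookup p m * monomial_eval m x)"
  unfolding poly_eval_def monomial_eval_def[symmetric]
  by (rule sum.mono_neutral_left) (use assms in \<open>auto simp: in_keys_iff\<close>)

lemma poly_eval_add: "poly_eval (p + q) x = poly_eval p x + poly_eval q x"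
proof -
  let ?S = "Poly_Mapping.keys p \<union> Poly_Mapping.keys q"
  have "poly_eval (p + q) x = (\<Sum>m\<in>?S. Poly_Mapping.lookup (p + q) m * monomial_eval m x)"
    by (rule poly_eval_superset) (use keys_add[of p q] in auto)
  then show ?thesis
    using poly_eval_superset[of ?S p x] poly_eval_superset[of ?S q x]
    by (simp add: lookup_add distrib_right sum.distrib)
qed

lemma poly_eval_single: "poly_eval (Poly_Mapping.single m c) x = c * monomial_eval m x"
  by (simp add: poly_eval_def monomial_eval_def)

lemma poly_eval_zero: "poly_eval 0 x = 0"
  by (simp add: poly_eval_def)

lemma poly_eval_sum: "poly_eval (sum f S) x = (\<Sum>i\<in>S. poly_eval (f i) x)"
  by (induction S rule: infinite_finite_induct) (simp_all add: poly_eval_zero poly_eval_add)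

lemma poly_eval_uminus: "poly_eval (- p) x = - poly_eval p x"
  using poly_eval_add[of p "- p" x] by (simp add: poly_eval_zero add_eq_0_iff)

lemma sum_single_keys:
  "(\<Sum>m\<in>Poly_Mapping.keys p. Poly_Mapping.single m (Poly_Mapping.lookup p m)) = p"
  by (rule poly_mapping_eqI) (auto simp: lookup_sum lookup_single when_def in_keys_iff)

lemma poly_eval_mult: "poly_eval (p * q) x = poly_eval p x * poly_eval q x"
proof -
  let ?c = Poly_Mapping.lookup and ?s = Poly_Mapping.single
  have "p * q = (\<Sum>m\<in>Poly_Mapping.keys p. ?s m (?c p m)) * (\<Sum>m'\<in>Poly_Mapping.keys q. ?s m' (?c q m'))"
    by (simp only: sum_single_keys)
  also have "\<dots> = (\<Sum>m\<in>Poly_Mapping.keys p. \<Sum>m'\<in>Poly_Mapping.keys q. ?s (m + m') (?c p m * ?c q m'))"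
    by (simp add: sum_product mult_single)
  finally have "poly_eval (p * q) x = (\<Sum>m\<in>Poly_Mapping.keys p. \<Sum>m'\<in>Poly_Mapping.keys q.
      (?c p m * monomial_eval m x) * (?c q m' * monomial_eval m' x))"
    by (simp add: poly_eval_sum poly_eval_single monomial_eval_add mult_ac)
  then show ?thesis
    by (simp add: poly_eval_def monomial_eval_def[symmetric] sum_product)
qed

lemma poly_vars_add: "poly_vars (p + q) \<subseteq> poly_vars p \<union> poly_vars q"
  unfolding poly_vars_def using keys_add[of p q] by blast

lemma poly_vars_uminus: "poly_vars (- p) = poly_vars p"
  unfolding poly_vars_def by (simp add: keys.rep_eq uminus_poly_mapping.rep_eq)

lemma poly_vars_mult: "poly_vars (p * q) \<subseteq> poly_vars p \<union> poly_vars q"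
proof
  fix v assume "v \<in> poly_vars (p * q)"
  then obtain m m' where "m \<in> Poly_Mapping.keys p" "m' \<in> Poly_Mapping.keys q"
    "v \<in> Poly_Mapping.keys (m + m')"
    unfolding poly_vars_def using keys_mult[of p q] by blast
  then show "v \<in> poly_vars p \<union> poly_vars q"
    unfolding poly_vars_def using keys_add[of m m'] by blast
qed

lemma poly_vars_single: "poly_vars (Poly_Mapping.single m c) \<subseteq> Poly_Mapping.keys m"
  by (simp add: poly_vars_def)

lemma poly_eval_variable: "poly_eval (Poly_Mapping.single (Poly_Mapping.single v 1) 1) x = x v"
  by (simp add: poly_eval_single monomial_eval_def)

lemma poly_eval_const: "poly_eval (Poly_Mapping.single 0 c) x = c"
  by (simp add: poly_eval_single monomial_eval_def)

section \<open>Principal minors as signed sums over permutations of the index set\<close>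

lemma bij_betw_pick:
  assumes "finite I"
  shows "bij_betw (pick I) {0..<card I} I"
proof -
  have "inj_on (pick I) {0..<card I}"
    by (rule linorder_inj_onI') (use pick_mono_le in fastforce)
  moreover have "pick I ` {0..<card I} \<subseteq> I" using pick_in_set_le by auto
  ultimately show ?thesis
    using assms card_image[of "pick I" "{0..<card I}"] card_subset_eq[OF assms]
    by (simp add: bij_betw_def)
qed

text \<open>The Leibniz formula, transported from \<open>{0..<card I}\<close> to \<open>I\<close>
  along the increasing enumeration \<open>pick I\<close>. The signs are chosen before the matrix, so
  the expansion is an identity between functions of the matrix.\<close>

lemma principal_minor_expansion:
  assumes "I \<subseteq> {..<n}"
  shows "\<exists>s. (\<forall>p. s p \<in> {1, - 1 :: int}) \<and> (\<forall>A\<in>carrier_mat n n.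
    principal_minor A I = (\<Sum>p | p permutes I. of_int (s p) * perm_weight (\<lambda>i j. A $$ (i, j)) I p))"
proof -
  define g k where "g = pick I" and "k = card I"
  have fin: "finite I" using assms finite_subset by blast
  have g: "bij_betw g {0..<k} I" unfolding g_def k_def by (rule bij_betw_pick[OF fin])
  define F where "F q = (\<lambda>x. if x \<in> I then g (q (inv_into {0..<k} g x)) else x)" for q
  let ?P = "{q. q permutes {0..<k}}" and ?Q = "{p. p permutes I}"
  have F: "bij_betw F ?P ?Q"
    using bij_betw_permutations[OF g] unfolding F_def[abs_def] .
  \<comment> \<open>For \<open>p\<close> outside the range of \<open>F\<close> the inverse is
    arbitrary, yet the sign is still \<open>1\<close> or \<open>-1\<close>, as the statement asks
    for every \<open>p\<close>.\<close>
  define s where "s p = sign (inv_into ?P F p)" for p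
  have "principal_minor A I = (\<Sum>p\<in>?Q. of_int (s p) * perm_weight (\<lambda>i j. A $$ (i, j)) I p)"
    if A: "A \<in> carrier_mat n n" for A
  proof -
    have rc: "{i. i < n \<and> i \<in> I} = I" using assms by auto
    have S: "submatrix A I I = mat k k (\<lambda>(i, j). A $$ (g i, g j))"
      using A unfolding submatrix_def g_def k_def by (simp add: rc)
    have "principal_minor A I = (\<Sum>q\<in>?P. signof q * (\<Prod>i=0..<k. A $$ (g i, g (q i))))"
      unfolding principal_minor_def S
      by (subst det_def'[of _ k]) (auto intro!: sum.cong prod.cong simp: permutes_in_image
          dest: permutes_in_image)
    also have "\<dots> = (\<Sum>q\<in>?P. of_int (s (F q)) * perm_weight (\<lambda>i j. A $$ (i, j)) I (F q))"
    proof (rule sum.cong[OF refl])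
      fix q assume q: "q \<in> ?P"
      have "s (F q) = sign q"
        unfolding s_def using bij_betw_inv_into_left[OF F q] by simp
      moreover have "perm_weight (\<lambda>i j. A $$ (i, j)) I (F q) = (\<Prod>i=0..<k. A $$ (g i, F q (g i)))"
        unfolding perm_weight_def by (rule prod.reindex_bij_betw[OF g, symmetric])
      moreover have "F q (g i) = g (q i)" if "i \<in> {0..<k}" for i
        unfolding F_def using bij_betwE[OF g] bij_betw_inv_into_left[OF g that] that by simp
      ultimately show "signof q * (\<Prod>i=0..<k. A $$ (g i, g (q i))) =
          of_int (s (F q)) * perm_weight (\<lambda>i j. A $$ (i, j)) I (F q)"
        by simp
    qed
    also have "\<dots> = (\<Sum>p\<in>?Q. of_int (s p) * perm_weight (\<lambda>i j. A $$ (i, j)) I p)"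
      by (rule sum.reindex_bij_betw[OF F])
    finally show ?thesis .
  qed
  moreover have "\<forall>p. s p \<in> {1, - 1}" unfolding s_def by (simp add: sign_def)
  ultimately show ?thesis by blast
qed

lemma sum_fun_apply: "(\<Sum>i\<in>S. f i) x = (\<Sum>i\<in>S. f i x)"
  by (induction S rule: infinite_finite_induct) simp_all

lemma prod_fun_apply: "(\<Prod>i\<in>S. f i) x = (\<Prod>i\<in>S. f i x)"
  by (induction S rule: infinite_finite_induct) simp_all

lemma uminus_fun_apply: "(- f) x = - f x"
  by (simp add: fun_Compl_def)

lemma of_int_sign_fun_apply: "s \<in> {1, - 1} \<Longrightarrow> (of_int s :: 'a \<Rightarrow> 'b::comm_ring_1) x = of_int s"
  by (auto simp: uminus_fun_apply)

theorem theorem1: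
  fixes n :: nat
  assumes "n \<ge> 1"
  shows "zariski_closed_in (Pow {..<n}) (affine_principal_minor_map n ` carrier_mat n n)"
proof -
  let ?J = "Pow {..<n}" and ?V = "{..<n}"
  let ?im = "affine_principal_minor_map n ` carrier_mat n n"
  \<comment> \<open>Matrices are parametrized by all functions of two indices, so that complex
    functions of them form the commutative ring in which \<open>H\<close> lives.\<close>
  define M where "M x = mat n n (\<lambda>(i, j). x i j)" for x :: "nat \<Rightarrow> nat \<Rightarrow> complex"
  define \<mu> where "\<mu> x = affine_principal_minor_map n (M x)" for x
  have M: "M x \<in> carrier_mat n n" for x unfolding M_def by simp
  have \<mu>_in: "\<mu> x \<in> ?im" for x unfolding \<mu>_def using M by blast
  define Z where "Z = {p :: nat set cpoly. poly_vars p \<subseteq> ?J \<and> (\<forall>y\<in>?im. poly_eval p y = 0)}"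
  have "y \<in> ?im" if y: "y \<in> zero_locus ?J Z" for y
  proof -
    \<comment> \<open>A polynomial in the minors is sent to the value of the same polynomial at
      \<open>y\<close>. This is well defined because every relation holding on the image lies in
      \<open>Z\<close> and therefore holds at \<open>y\<close>.\<close>
    define H where "H = {(\<lambda>x. poly_eval p (\<mu> x), poly_eval p y) | p. poly_vars p \<subseteq> ?J}"
    have HI: "(f, u) \<in> H" if "poly_vars p \<subseteq> ?J" "f = (\<lambda>x. poly_eval p (\<mu> x))" "u = poly_eval p y"
      for p f u
      using that unfolding H_def by blast
    have const: "((\<lambda>_. c), c) \<in> H" for c
      by (rule HI[of "Poly_Mapping.single 0 c"])
        (use poly_vars_single[of 0 c] in \<open>auto simp: poly_eval_const\<close>)
    interpret H: partial_hom H
    proof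
      show "\<exists>r. (r, z) \<in> H" for z using const by blast
      show "(1, 1) \<in> H" using const[of 1] by (simp add: one_fun_def)
      show "v = 0" if v: "(0, v) \<in> H" for v
      proof -
        obtain p where p: "poly_vars p \<subseteq> ?J" "(\<lambda>x. poly_eval p (\<mu> x)) = 0" "v = poly_eval p y"
          using v unfolding H_def by auto
        have "poly_eval p (affine_principal_minor_map n A) = 0" if A: "A \<in> carrier_mat n n" for A
        proof -
          have "M (\<lambda>i j. A $$ (i, j)) = A" using A unfolding M_def by (intro eq_matI) auto
          then show ?thesis
            using fun_cong[OF p(2), of "\<lambda>i j. A $$ (i, j)"] unfolding \<mu>_def by simp
        qed
        then have "p \<in> Z" using p(1) unfolding Z_def by blast
        then show ?thesis using y p(3) unfolding zero_locus_def by blast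
      qed
      fix f u assume "(f, u) \<in> H"
      then obtain p where p: "poly_vars p \<subseteq> ?J" "f = (\<lambda>x. poly_eval p (\<mu> x))" "u = poly_eval p y"
        unfolding H_def by blast
      show "(- f, - u) \<in> H"
        by (rule HI[of "- p"]) (auto simp: p poly_eval_uminus poly_vars_uminus fun_Compl_def
            dest: subsetD[OF p(1)])
      fix g v assume "(g, v) \<in> H"
      then obtain q where q: "poly_vars q \<subseteq> ?J" "g = (\<lambda>x. poly_eval q (\<mu> x))" "v = poly_eval q y"
        unfolding H_def by blast
      show "(f + g, u + v) \<in> H"
        by (rule HI[of "p + q"])
          (use poly_vars_add[of p q] p q in \<open>auto simp: poly_eval_add plus_fun_def\<close>)
      show "(f * g, u * v) \<in> H"
        by (rule HI[of "p * q"])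
          (use poly_vars_mult[of p q] p q in \<open>auto simp: poly_eval_mult times_fun_def\<close>)
    qed
    \<comment> \<open>The entries of the generic matrix, as coordinate functions.\<close>
    define a where "a i j = (\<lambda>x :: nat \<Rightarrow> nat \<Rightarrow> complex. x i j)" for i j
    have "\<forall>I\<in>?J. \<exists>s. (\<forall>p. s p \<in> {1, - 1 :: int}) \<and>
        (\<forall>A\<in>carrier_mat n n. principal_minor A I =
          (\<Sum>p | p permutes I. of_int (s p) * perm_weight (\<lambda>i j. A $$ (i, j)) I p))"
      using principal_minor_expansion by simp
    from bchoice[OF this] obtain s where "\<forall>I\<in>?J. (\<forall>p. s I p \<in> {1, - 1 :: int}) \<and>
        (\<forall>A\<in>carrier_mat n n. principal_minor A I =
          (\<Sum>p | p permutes I. of_int (s I p) * perm_weight (\<lambda>i j. A $$ (i, j)) I p))"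
      by (rule exE)
    then have s: "\<And>I p. I \<subseteq> ?V \<Longrightarrow> s I p \<in> {1, - 1 :: int}"
      and minor: "\<And>I A. I \<subseteq> ?V \<Longrightarrow> A \<in> carrier_mat n n \<Longrightarrow> principal_minor A I =
        (\<Sum>p | p permutes I. of_int (s I p) * perm_weight (\<lambda>i j. A $$ (i, j)) I p)"
      by simp_all
    have perm_M: "perm_weight (\<lambda>i j. M x $$ (i, j)) I p = perm_weight x I p"
      if "I \<subseteq> ?V" "p permutes I" for x I p
      unfolding perm_weight_def M_def using that permutes_in_image[OF that(2)]
      by (intro prod.cong) (auto simp: subset_iff)
    have minor_M: "principal_minor (M x) I = (\<Sum>p | p permutes I. of_int (s I p) * perm_weight x I p)"
      if "I \<subseteq> ?V" for x I
      unfolding minor[OF that M] using perm_M[OF that] by (intro sum.cong) auto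
    have minor_H: "((\<Sum>p | p permutes I. of_int (s I p) * perm_weight a I p), y I) \<in> H"
      if I: "I \<subseteq> ?V" for I
    proof (rule HI)
      let ?p = "Poly_Mapping.single (Poly_Mapping.single I 1) (1 :: complex)"
      show "poly_vars ?p \<subseteq> ?J" using poly_vars_single[of "Poly_Mapping.single I 1" 1] I by auto
      show "y I = poly_eval ?p y" by (rule poly_eval_variable[symmetric])
      show "(\<Sum>p | p permutes I. of_int (s I p) * perm_weight a I p) = (\<lambda>x. poly_eval ?p (\<mu> x))"
      proof
        fix x
        have "perm_weight a I p x = perm_weight x I p" for p
          by (simp add: perm_weight_def prod_fun_apply a_def)
        then show "(\<Sum>p | p permutes I. of_int (s I p) * perm_weight a I p) x = poly_eval ?p (\<mu> x)"
          using I s[OF I] unfolding poly_eval_variable \<mu>_def affine_principal_minor_map_def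
          by (simp add: sum_fun_apply of_int_sign_fun_apply minor_M)
      qed
    qed
    have "\<exists>s. (\<forall>p. s p \<in> {1, - 1 :: int}) \<and>
        (\<Sum>p | p permutes I. of_int (s p) * perm_weight a I p) \<in> Domain H" if "I \<subseteq> ?V" for I
      using s[OF that] minor_H[OF that] by (intro exI[of _ "s I"]) blast
    then obtain H' where H': "partial_hom H'" "H \<subseteq> H'"
      and cyc: "\<And>xs. xs \<noteq> [] \<Longrightarrow> set xs \<subseteq> ?V \<Longrightarrow> cycle_weight a xs \<in> Domain H'"
      using Domain_all_cycle_weights_extend[OF _ H.partial_hom_axioms, of ?V a] by auto
    interpret H': partial_hom H' by fact
    obtain b where b: "\<And>xs. xs \<noteq> [] \<Longrightarrow> set xs \<subseteq> ?V \<Longrightarrow> (cycle_weight a xs, cycle_weight b xs) \<in> H'"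
      using H'.realize_cycle_weights[OF cyc] by blast
    have "y I = principal_minor (M b) I" if I: "I \<subseteq> ?V" for I
    proof -
      have fin: "finite I" using I finite_subset by blast
      \<comment> \<open>In \<open>H'\<close> the generic minor on \<open>I\<close> has the value
        \<open>y I\<close>, from \<open>H\<close>, and the minor of \<open>M b\<close>, from the
        cycle weights; uniqueness of values identifies the two.\<close>
      have sums: "((\<Sum>p | p permutes I. of_int (s I p) * perm_weight a I p),
          (\<Sum>p | p permutes I. of_int (s I p) * perm_weight b I p)) \<in> H'"
        using H'.realize_perm_weights[OF b _ fin I] H'.sign[OF s[OF I]]
        by (intro H'.sum H'.mult) auto
      show ?thesis
        unfolding minor_M[OF I] by (rule H'.unique[OF subsetD[OF H'(2) minor_H[OF I]] sums])
    qed
    moreover have "y \<in> extensional ?J"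
      using y unfolding zero_locus_def affine_space_def PiE_def by blast
    ultimately have "y = affine_principal_minor_map n (M b)"
      unfolding affine_principal_minor_map_def by (intro extensionalityI[of _ ?J]) auto
    then show ?thesis using M by blast
  qed
  moreover have "affine_principal_minor_map n A \<in> affine_space ?J" for A
    unfolding affine_space_def affine_principal_minor_map_def by (simp add: PiE_def)
  then have "?im \<subseteq> zero_locus ?J Z"
    unfolding zero_locus_def Z_def by blast
  ultimately have "?im = zero_locus ?J Z" by blast
  moreover have "\<forall>p\<in>Z. poly_vars p \<subseteq> ?J" unfolding Z_def by simp
  ultimately show ?thesis unfolding zariski_closed_in_def by blast
qed

end
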